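(* Let $\Gamma$ be a group with $|\Gamma|=n!$ acting on a finite set $X$ with distinguishing number $D_\Gamma(X)=n$. Then there is an orbit $\Gamma.x$ in $X$ with exactly $n$ elements on which $\Gamma$ acts as the set of all possible permutations (i.e. the induced map $\Gamma\to\mathrm{Sym}(\Gamma.x)$ is a bijection), and every other orbit of $\Gamma$ in $X$ has size $1$.
   Context: For a group $\Gamma$ acting on a set $X$, write $g.x$ for the action, $\Gamma.x$ for the orbit, and $\mathrm{Stab}_\Gamma(Y)=\{g\in\Gamma: g.y=y \text{ for all } y\in Y\}$. A labelling $\phi:X\to\{1,\dots,k\}$ is $k$-distinguishing if $\{g\in\Gamma:\phi(g.x)=\phi(x)\text{ for all }x\}=\mathrm{Stab}_\Gamma(X)$. The distinguishing number $D_\Gamma(X)$ is the minimum $k$ for which a $k$-distinguishing labelling exists.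
   Formalization: The claim that every other orbit has size 1 is asserted only for n ≠ 2, since it fails for n = 2 (Z/2 acting on four points by (a b)(c d) has D = 2 and two orbits of size 2); also n ≥ 1 is assumed, which excludes the empty set X. *)

theory Defs
  imports "HOL-Algebra.Group_Action"
begin

definition pointwise_stabilizer ::
  "[('a, 'c) monoid_scheme, 'a \<Rightarrow> 'b \<Rightarrow> 'b, 'b set] \<Rightarrow> 'a set"
  where "pointwise_stabilizer G act Y = {g \<in> carrier G. \<forall>y\<in>Y. act g y = y}"

definition distinguishing_labelling ::
  "[('a, 'c) monoid_scheme, 'b set, 'a \<Rightarrow> 'b \<Rightarrow> 'b, nat, 'b \<Rightarrow> nat] \<Rightarrow> bool"
  where "distinguishing_labelling G X act k f \<longleftrightarrow>
    f \<in> X \<rightarrow> {1..k} \<and>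
    {g \<in> carrier G. \<forall>x\<in>X. f (act g x) = f x} = pointwise_stabilizer G act X"

text \<open>For finite \<open>X\<close> an injective labelling is distinguishing, so the minimum below is attained.
  It is \<open>0\<close> exactly when \<open>X\<close> is empty.\<close>

definition distinguishing_number ::
  "[('a, 'c) monoid_scheme, 'b set, 'a \<Rightarrow> 'b \<Rightarrow> 'b] \<Rightarrow> nat"
  where "distinguishing_number G X act = (LEAST k. \<exists>f. distinguishing_labelling G X act k f)"

text \<open>The induced map into the symmetric group of an invariant subset \<open>Y\<close>; restriction is needed
  because the carrier of \<open>BijGroup Y\<close> contains only functions that are extensional on \<open>Y\<close>.\<close>

definition induced_action :: "['a \<Rightarrow> 'b \<Rightarrow> 'b, 'b set] \<Rightarrow> 'a \<Rightarrow> 'b \<Rightarrow> 'b"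
  where "induced_action act Y g = restrict (act g) Y"

end

theory Submission
  imports Defs "HOL-Combinatorics.Permutations"
begin

text \<open>Let \<open>N\<close> be the kernel of the action. If \<open>|\<Gamma>| < (k + 1)! |N|\<close>, then \<open>k\<close> labels suffice: when
  all orbits have at most \<open>k\<close> points, label each orbit injectively; otherwise give a point of an
  orbit with more than \<open>k\<close> points a label of its own and apply induction to its stabilizer. Hence
  \<open>|\<Gamma>| = n!\<close> and \<open>D = n\<close> force \<open>N = 1\<close> and a largest orbit \<open>B\<close> of size exactly \<open>n\<close>. If the
  stabilizer of some \<open>z \<in> B\<close> moved a point \<open>y \<notin> B\<close>, then the common stabilizer of \<open>z\<close> and \<open>y\<close> would
  have order less than \<open>(n - 1)!\<close>, so \<open>n - 2\<close> labels would suffice for it; one further label shared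
  by \<open>z\<close> and \<open>y\<close> would give a distinguishing labelling of \<open>X\<close> with \<open>n - 1\<close> labels. So stabilizers of
  points of \<open>B\<close> fix everything outside \<open>B\<close>. In particular \<open>\<Gamma>\<close> is faithful on \<open>B\<close>, hence all of
  \<open>Sym(B)\<close>, and for \<open>n \<ge> 3\<close> it is generated by these stabilizers.\<close>

text \<open>Restriction to \<open>S\<close> and extension by the identity are mutually inverse
  between the maps that \<open>permutes\<close> describes and the extensional bijections in
  \<open>Bij S\<close>.\<close>

lemma card_carrier_BijGroup:
  assumes "finite S"
  shows "card (carrier (BijGroup S)) = fact (card S)"
proof -
  have "bij_betw (\<lambda>p. restrict p S) {p. p permutes S} (Bij S)"
  proof (rule bij_betwI[where g = "\<lambda>f. restrict_id f S"])
    show "(\<lambda>p. restrict p S) \<in> {p. p permutes S} \<rightarrow> Bij S"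
      by (auto simp: Bij_def permutes_imp_bij)
    show "(\<lambda>f. restrict_id f S) \<in> Bij S \<rightarrow> {p. p permutes S}"
    proof
      fix f assume "f \<in> Bij S"
      then have "bij_betw f S S" by (simp add: Bij_def)
      then have "bij_betw (restrict_id f S) S S"
        by (rule bij_betw_cong[THEN iffD1, rotated]) simp
      then show "restrict_id f S \<in> {p. p permutes S}"
        by (auto intro: bij_imp_permutes)
    qed
    show "restrict_id (restrict p S) S = p" if "p \<in> {p. p permutes S}" for p
      using that by (auto simp: restrict_id_def permutes_not_in)
    show "restrict (restrict_id f S) S = f" if "f \<in> Bij S" for f
      using that by (auto simp: Bij_def restrict_id_def extensional_def)
  qed
  then show ?thesis
    using card_permutations[OF refl assms] by (simp add: BijGroup_def bij_betw_same_card)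
qed

context group_action
begin

lemma act_one: "x \<in> E \<Longrightarrow> \<phi> \<one> x = x"
  using id_eq_one by (metis restrict_apply')

lemma act_closed: "g \<in> carrier G \<Longrightarrow> x \<in> E \<Longrightarrow> \<phi> g x \<in> E"
  using element_image by blast

lemma orbit_subset: "x \<in> E \<Longrightarrow> orbit G \<phi> x \<subseteq> E"
  unfolding orbit_def using act_closed by blast

lemma act_in_orbit: "g \<in> carrier G \<Longrightarrow> \<phi> g x \<in> orbit G \<phi> x"
  unfolding orbit_def by blast

lemma orbit_eqI:
  assumes "x \<in> E" "y \<in> orbit G \<phi> x"
  shows "orbit G \<phi> y = orbit G \<phi> x"
proof -
  have "y \<in> E" using assms orbit_subset by blast
  then have "y \<in> orbit G \<phi> y" by (rule orbit_refl)
  then show ?thesis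
    using disjoint_union[of "orbit G \<phi> y" "orbit G \<phi> x"] assms \<open>y \<in> E\<close>
    unfolding orbits_def by blast
qed

lemma pointwise_stabilizer_subgroup:
  assumes "Y \<subseteq> E"
  shows "subgroup (pointwise_stabilizer G \<phi> Y) G"
proof -
  interpret group G using group_hom group_hom.axioms(1) by blast
  show ?thesis
  proof (rule subgroupI)
    show "pointwise_stabilizer G \<phi> Y \<noteq> {}"
      using assms act_one unfolding pointwise_stabilizer_def by blast
    show "inv a \<in> pointwise_stabilizer G \<phi> Y" if "a \<in> pointwise_stabilizer G \<phi> Y" for a
      using that assms orbit_sym_aux unfolding pointwise_stabilizer_def by blast
    show "a \<otimes> b \<in> pointwise_stabilizer G \<phi> Y"
      if "a \<in> pointwise_stabilizer G \<phi> Y" "b \<in> pointwise_stabilizer G \<phi> Y" for a b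
      using that assms composition_rule unfolding pointwise_stabilizer_def by auto
  qed (auto simp: pointwise_stabilizer_def)
qed

text \<open>An element acting trivially on \<open>E\<close> already fixes \<open>Y\<close>, so the
  kernel survives the passage to a stabilizer. This keeps the kernel factor constant when the group
  shrinks.\<close>

lemma pointwise_stabilizer_restrict_carrier:
  assumes "Y \<subseteq> E"
  shows "pointwise_stabilizer (G\<lparr>carrier := pointwise_stabilizer G \<phi> Y\<rparr>) \<phi> E
    = pointwise_stabilizer G \<phi> E"
  using assms unfolding pointwise_stabilizer_def by auto

lemma stabilizer_eq_pointwise_stabilizer:
  "stabilizer G \<phi> x = pointwise_stabilizer G \<phi> {x}"
  unfolding stabilizer_def pointwise_stabilizer_def by simp

text \<open>Elements acting trivially preserve every labelling, so only one inclusion has to be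
  checked.\<close>

lemma distinguishing_labellingI:
  assumes "f \<in> E \<rightarrow> {1..k}"
    and "\<And>g x. g \<in> carrier G \<Longrightarrow> \<forall>x\<in>E. f (\<phi> g x) = f x \<Longrightarrow> x \<in> E \<Longrightarrow> \<phi> g x = x"
  shows "distinguishing_labelling G E \<phi> k f"
  using assms unfolding distinguishing_labelling_def pointwise_stabilizer_def by auto

lemma distinguishing_labelling_of_small_orbits:
  assumes "finite E" "\<And>x. x \<in> E \<Longrightarrow> card (orbit G \<phi> x) \<le> k"
  shows "\<exists>f. distinguishing_labelling G E \<phi> k f"
proof -
  have "\<exists>h. h ` orbit G \<phi> x \<subseteq> {1..k} \<and> inj_on h (orbit G \<phi> x)" if "x \<in> E" for x
    using assms that orbit_subset[OF that]
    by (intro card_le_inj) (auto intro: finite_subset)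
  \<comment> \<open>The choice is made per orbit, not per point, so that all points of an orbit use
    the same injection. Different orbits may share labels.\<close>
  then have "\<exists>h. \<forall>Y\<in>orbits G E \<phi>. h Y ` Y \<subseteq> {1..k} \<and> inj_on (h Y) Y"
    by (intro bchoice) (auto simp: orbits_def)
  then obtain h where h: "\<And>x. x \<in> E \<Longrightarrow> h (orbit G \<phi> x) ` orbit G \<phi> x \<subseteq> {1..k}"
    "\<And>x. x \<in> E \<Longrightarrow> inj_on (h (orbit G \<phi> x)) (orbit G \<phi> x)"
    unfolding orbits_def by auto
  have "distinguishing_labelling G E \<phi> k (\<lambda>x. h (orbit G \<phi> x) x)"
  proof (rule distinguishing_labellingI)
    show "(\<lambda>x. h (orbit G \<phi> x) x) \<in> E \<rightarrow> {1..k}"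
      using h(1) orbit_refl by blast
  next
    fix g x
    assume g: "g \<in> carrier G" and x: "x \<in> E"
      and "\<forall>x\<in>E. h (orbit G \<phi> (\<phi> g x)) (\<phi> g x) = h (orbit G \<phi> x) x"
    then have "h (orbit G \<phi> x) (\<phi> g x) = h (orbit G \<phi> x) x"
      using orbit_eqI[OF x act_in_orbit[OF g]] by metis
    then show "\<phi> g x = x"
      using h(2)[OF x] act_in_orbit[OF g] orbit_refl[OF x] by (auto dest: inj_onD)
  qed
  then show ?thesis by blast
qed

text \<open>A single new label on all of \<open>T\<close> forces every label-preserving element to fix \<open>T\<close> pointwise,
  because \<open>T\<close> contains at most one point of each orbit.\<close>

lemma distinguishing_labelling_extend:
  assumes T: "T \<subseteq> E" "\<And>x y. x \<in> T \<Longrightarrow> y \<in> T \<Longrightarrow> y \<in> orbit G \<phi> x \<Longrightarrow> y = x"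
    and f: "distinguishing_labelling (G\<lparr>carrier := pointwise_stabilizer G \<phi> T\<rparr>) E \<phi> k f"
  shows "distinguishing_labelling G E \<phi> (Suc k) (\<lambda>x. if x \<in> T then Suc k else f x)"
    (is "distinguishing_labelling G E \<phi> (Suc k) ?f")
proof (rule distinguishing_labellingI)
  have range: "f \<in> E \<rightarrow> {1..k}"
    using f unfolding distinguishing_labelling_def by blast
  then show "?f \<in> E \<rightarrow> {1..Suc k}" by force
  fix g x
  assume g: "g \<in> carrier G" and pres: "\<forall>x\<in>E. ?f (\<phi> g x) = ?f x" and x: "x \<in> E"
  have less: "f z < Suc k" if "z \<in> E" for z
    using range that by (auto simp: Pi_iff less_Suc_eq_le)
  \<comment> \<open>The label \<open>Suc k\<close> lies outside the range of \<open>f\<close>, so it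
    occurs exactly on \<open>T\<close>.\<close>
  have T_iff: "\<phi> g z \<in> T \<longleftrightarrow> z \<in> T" if "z \<in> E" for z
    using pres[rule_format, OF that] less[OF that] less[OF act_closed[OF g that]]
    by (auto split: if_splits)
  have "g \<in> pointwise_stabilizer G \<phi> T"
    unfolding pointwise_stabilizer_def using g T T_iff act_in_orbit[OF g] by blast
  moreover from this have "f (\<phi> g z) = f z" if "z \<in> E" for z
    using pres[rule_format, OF that] T_iff[OF that]
    by (cases "z \<in> T") (auto simp: pointwise_stabilizer_def)
  ultimately have "g \<in> pointwise_stabilizer G \<phi> E"
    using f pointwise_stabilizer_restrict_carrier[OF T(1)]
    unfolding distinguishing_labelling_def by auto
  then show "\<phi> g x = x" using x unfolding pointwise_stabilizer_def by blast
qed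

end

text \<open>Stabilizing a point whose orbit has at least \<open>k + 2\<close> points divides the
  order by at least \<open>k + 2\<close>, which is the factor lost between
  \<open>fact (k + 2)\<close> and \<open>fact (k + 1)\<close>; the kernel is unchanged. The label
  saved for the stabilizer goes to the point.\<close>

lemma distinguishing_labelling_of_small_order:
  assumes "group_action G X act" "finite X" "finite (carrier G)"
    and "order G < fact (Suc k) * card (pointwise_stabilizer G act X)"
  shows "\<exists>f. distinguishing_labelling G X act k f"
  using assms(1,3,4)
proof (induction k arbitrary: G)
  case 0
  \<comment> \<open>For \<open>k = 0\<close> the bound would make the group smaller than its own
    kernel.\<close>
  then have "card (pointwise_stabilizer G act X) \<le> order G"
    unfolding order_def pointwise_stabilizer_def by (intro card_mono) auto
  with 0 show ?case by simp
next
  case (Suc k)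
  then interpret group_action G X act by simp
  show ?case
  proof (cases "\<forall>x\<in>X. card (orbit G act x) \<le> Suc k")
    case True
    then show ?thesis using distinguishing_labelling_of_small_orbits assms(2) by blast
  next
    case False
    then obtain x where x: "x \<in> X" and big: "Suc (Suc k) \<le> card (orbit G act x)"
      by (auto simp: not_le Suc_le_eq)
    let ?H = "G\<lparr>carrier := pointwise_stabilizer G act {x}\<rparr>"
    have "card (orbit G act x) * order ?H = order G"
      using orbit_stabilizer_theorem[OF x]
      by (simp add: order_def stabilizer_eq_pointwise_stabilizer)
    then have "Suc (Suc k) * order ?H \<le> order G"
      using mult_le_mono1[OF big] by metis
    also have "\<dots> < Suc (Suc k) * (fact (Suc k) * card (pointwise_stabilizer G act X))"
      using Suc.prems(3) by (simp only: fact_Suc[of "Suc k"] of_nat_id mult.assoc)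
    finally have "order ?H < fact (Suc k) * card (pointwise_stabilizer G act X)"
      by (simp only: mult_less_cancel1)
    then have "order ?H < fact (Suc k) * card (pointwise_stabilizer ?H act X)"
      using pointwise_stabilizer_restrict_carrier[of "{x}"] x by simp
    moreover have "group_action ?H X act"
      using induced_action pointwise_stabilizer_subgroup x by blast
    moreover have "finite (carrier ?H)"
      using Suc.prems(2) by (simp add: pointwise_stabilizer_def)
    ultimately obtain f where "distinguishing_labelling ?H X act k f"
      using Suc.IH by blast
    then show ?thesis
      using distinguishing_labelling_extend[of "{x}"] x by blast
  qed
qed

theorem theorem2p15:
  fixes G :: "('a, 'c) monoid_scheme"
    and X :: "'b set"
    and act :: "'a \<Rightarrow> 'b \<Rightarrow> 'b"
    and n :: nat
  assumes "group_action G X act"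
    and "finite X"
    and "n \<ge> 1"
    and "order G = fact n"
    and "distinguishing_number G X act = n"
  shows "\<exists>x\<in>X. card (orbit G act x) = n \<and>
    bij_betw (induced_action act (orbit G act x))
      (carrier G) (carrier (BijGroup (orbit G act x))) \<and>
    (n \<noteq> 2 \<longrightarrow> (\<forall>Y\<in>orbits G X act. Y \<noteq> orbit G act x \<longrightarrow> card Y = 1))"
proof -
  interpret group_action G X act by fact
  interpret group G using group_hom group_hom.axioms(1) by blast
  obtain m where n: "n = Suc m" using \<open>n \<ge> 1\<close> by (cases n) auto
  \<comment> \<open>\<open>card\<close> is 0 on infinite sets, whereas \<open>fact n\<close> is
    positive.\<close>
  have fin: "finite (carrier G)"
    using \<open>order G = fact n\<close> fact_nonzero[of n, where 'a = nat]
    by (metis card.infinite order_def)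
  have none: "\<not> distinguishing_labelling G X act m f" for f
  proof -
    have "m < (LEAST k. \<exists>f. distinguishing_labelling G X act k f)"
      using assms(5) n by (simp add: distinguishing_number_def)
    from not_less_Least[OF this] show ?thesis by blast
  qed

  \<comment> \<open>A kernel of size at least 2 would put \<open>fact n\<close> strictly below the
    bound of the order lemma, and \<open>m\<close> labels would suffice.\<close>
  have "card (pointwise_stabilizer G act X) = 1"
  proof -
    have "\<one>\<^bsub>G\<^esub> \<in> pointwise_stabilizer G act X"
      using pointwise_stabilizer_subgroup subgroup.one_closed by blast
    moreover have "finite (pointwise_stabilizer G act X)"
      using fin by (simp add: pointwise_stabilizer_def)
    ultimately have "card (pointwise_stabilizer G act X) > 0"
      by (auto simp: card_gt_0_iff)
    moreover have "\<not> order G < fact (Suc m) * card (pointwise_stabilizer G act X)"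
      using distinguishing_labelling_of_small_order[OF assms(1,2) fin] none by blast
    then have "\<not> 1 < card (pointwise_stabilizer G act X)"
      using assms(4) n by simp
    ultimately show ?thesis by linarith
  qed

  \<comment> \<open>Otherwise \<open>m - 1\<close> labels distinguish for the stabilizer of
    \<open>T\<close>, and one new label shared by \<open>T\<close> gives \<open>m\<close> labels for
    the whole group.\<close>
  have stab_large: "fact m \<le> card (pointwise_stabilizer G act T)"
    if T: "T \<subseteq> X" "\<And>x y. x \<in> T \<Longrightarrow> y \<in> T \<Longrightarrow> y \<in> orbit G act x \<Longrightarrow> y = x" for T
  proof (rule ccontr)
    let ?H = "G\<lparr>carrier := pointwise_stabilizer G act T\<rparr>"
    assume "\<not> fact m \<le> card (pointwise_stabilizer G act T)"
    then have less: "order ?H < fact m" by (simp add: order_def)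
    have fin_H: "finite (carrier ?H)"
      using fin by (simp add: pointwise_stabilizer_def)
    have "subgroup (pointwise_stabilizer G act T) G"
      using pointwise_stabilizer_subgroup T(1) by blast
    then have H: "group_action ?H X act" and "\<one>\<^bsub>G\<^esub> \<in> carrier ?H"
      using induced_action subgroup.one_closed by auto
    \<comment> \<open>The order lies strictly between 0 and \<open>fact m\<close>, which excludes
      \<open>m = 0\<close> and makes \<open>m - 1\<close> meaningful.\<close>
    then have "order ?H \<noteq> 0"
      using fin_H by (auto simp: order_def)
    with less obtain j where j: "m = Suc j" by (cases m) auto
    have "order ?H < fact (Suc j) * card (pointwise_stabilizer ?H act X)"
      using less j \<open>card (pointwise_stabilizer G act X) = 1\<close>
        pointwise_stabilizer_restrict_carrier[OF T(1)] by simp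
    from distinguishing_labelling_of_small_order[OF H assms(2) fin_H this]
    obtain f where "distinguishing_labelling ?H X act j f" by blast
    from distinguishing_labelling_extend[OF T(1) T(2) this] none j show False by blast
  qed

  obtain x where x: "x \<in> X" and "m < card (orbit G act x)"
    using distinguishing_labelling_of_small_orbits[OF assms(2)] none by (meson not_le)
  have orbit_stab: "card (orbit G act z) * card (pointwise_stabilizer G act {z}) = fact n"
    if "z \<in> X" for z
    using orbit_stabilizer_theorem[OF that] assms(4)
    by (simp add: stabilizer_eq_pointwise_stabilizer)
  have orbit_small: "card (orbit G act z) \<le> n" if "z \<in> X" for z
  proof -
    have "fact m \<le> card (pointwise_stabilizer G act {z})"
      using stab_large[of "{z}"] that by simp
    then have "card (orbit G act z) * fact m \<le> n * fact m"
      using orbit_stab[OF that] n by (metis fact_Suc mult_le_mono2 of_nat_id)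
    then show ?thesis by simp
  qed
  define B where "B = orbit G act x"
  have card_B: "card B = n"
    using orbit_small[OF x] \<open>m < card (orbit G act x)\<close> n by (simp add: B_def)
  have B_sub: "B \<subseteq> X" unfolding B_def using orbit_subset[OF x] .
  have fin_B: "finite B" using B_sub assms(2) finite_subset by blast
  have x_in_B: "x \<in> B" unfolding B_def using orbit_refl[OF x] .
  have orbit_B: "orbit G act z = B" if "z \<in> B" for z
    using orbit_eqI[OF x] that unfolding B_def by blast

  have fixes_outside: "act g y = y"
    if g: "g \<in> carrier G" and z: "z \<in> B" "act g z = z" and y: "y \<in> X" "y \<notin> B" for g y z
  proof -
    have zX: "z \<in> X" using z B_sub by blast
    let ?S = "pointwise_stabilizer G act {z}" and ?T = "pointwise_stabilizer G act {z, y}"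
    \<comment> \<open>The points \<open>z\<close> and \<open>y\<close> lie in different orbits, so
      \<open>stab_large\<close> applies to the pair. Its bound is the exact order of the stabilizer
      of \<open>z\<close>, hence the two stabilizers coincide.\<close>
    have "z \<notin> orbit G act y" "y \<notin> orbit G act z"
      using orbit_B[OF z(1)] y orbit_sym[OF y(1) zX] by auto
    then have "fact m \<le> card ?T"
      using stab_large[of "{z, y}"] zX y by auto
    moreover have "card ?S = fact m"
      using orbit_stab[OF zX] orbit_B[OF z(1)] card_B n
      by (metis Suc_mult_cancel1 fact_Suc of_nat_id)
    moreover have "?T \<subseteq> ?S" "finite ?S"
      using fin by (auto simp: pointwise_stabilizer_def)
    ultimately have "?T = ?S" using card_seteq by metis
    then show ?thesis using g z by (auto simp: pointwise_stabilizer_def)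
  qed

  have maps: "act g z \<in> B" if "g \<in> carrier G" "z \<in> B" for g z
    using act_in_orbit[OF that(1), of z] orbit_B[OF that(2)] by simp
  have kernel_trivial: "g = \<one>\<^bsub>G\<^esub>" if g: "g \<in> carrier G" and on_B: "\<And>z. z \<in> B \<Longrightarrow> act g z = z"
    for g
  proof -
    have "act g y = y" if "y \<in> X" for y
      using on_B fixes_outside[OF g x_in_B _ that] x_in_B by blast
    then have "g \<in> pointwise_stabilizer G act X" "\<one>\<^bsub>G\<^esub> \<in> pointwise_stabilizer G act X"
      using g act_one by (auto simp: pointwise_stabilizer_def)
    then show ?thesis
      using \<open>card (pointwise_stabilizer G act X) = 1\<close> by (auto simp: card_1_singleton_iff)
  qed

  have act_inv: "act (inv\<^bsub>G\<^esub> h) (act h z) = z" if "h \<in> carrier G" "z \<in> X" for h z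
    using orbit_sym_aux[OF that refl] .
  have bij: "bij_betw (induced_action act B) (carrier G) (carrier (BijGroup B))"
  proof -
    have inj: "inj_on (induced_action act B) (carrier G)"
    proof (rule inj_onI)
      fix g h assume g: "g \<in> carrier G" and h: "h \<in> carrier G"
        and eq: "induced_action act B g = induced_action act B h"
      have "act (inv\<^bsub>G\<^esub> h \<otimes>\<^bsub>G\<^esub> g) z = z" if "z \<in> B" for z
      proof -
        have "act g z = act h z"
          using fun_cong[OF eq, of z] that by (simp add: induced_action_def)
        then show ?thesis
          using composition_rule[of z "inv\<^bsub>G\<^esub> h" g] act_inv[OF h] that B_sub g h by auto
      qed
      then have "inv\<^bsub>G\<^esub> h \<otimes>\<^bsub>G\<^esub> g = \<one>\<^bsub>G\<^esub>" using kernel_trivial g h by blast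
      then show "g = h" using g h by (metis inv_equality inv_inv inv_closed)
    qed
    moreover have "induced_action act B ` carrier G \<subseteq> carrier (BijGroup B)"
    proof
      fix p assume "p \<in> induced_action act B ` carrier G"
      then obtain g where g: "g \<in> carrier G" and p: "p = restrict (act g) B"
        by (auto simp: induced_action_def)
      have "inj_on (act g) B" using inj_prop[OF g] B_sub inj_on_subset by blast
      moreover have "act g ` B \<subseteq> B" using maps[OF g] by blast
      ultimately have "bij_betw (act g) B B"
        using fin_B by (simp add: bij_betw_def endo_inj_surj)
      then show "p \<in> carrier (BijGroup B)"
        by (simp add: p BijGroup_def Bij_def)
    qed
    \<comment> \<open>Both sides have \<open>fact n\<close> elements, so injectivity yields
      surjectivity.\<close>
    moreover have "card (induced_action act B ` carrier G) = card (carrier (BijGroup B))"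
      using card_image[OF inj] card_carrier_BijGroup[OF fin_B] card_B assms(4)
      by (simp add: order_def)
    moreover have "finite (carrier (BijGroup B))"
      using card_carrier_BijGroup[OF fin_B] fact_nonzero[of "card B", where 'a = nat]
      by (metis card.infinite)
    ultimately show ?thesis by (simp add: bij_betw_def card_subset_eq)
  qed

  \<comment> \<open>For \<open>n = 2\<close> this fails: the group of order 2 may swap the points of
    two 2-point orbits simultaneously.\<close>
  have "card Y = 1" if "n \<noteq> 2" and Y: "Y \<in> orbits G X act" "Y \<noteq> B" for Y
  proof -
    obtain y where y: "y \<in> X" "Y = orbit G act y" using Y(1) by (auto simp: orbits_def)
    then have y_notin: "y \<notin> B" using orbit_B Y(2) by blast
    have "act g y = y" if g: "g \<in> carrier G" for g
    proof (cases "act g x = x")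
      case True
      then show ?thesis using fixes_outside g x_in_B y y_notin by blast
    next
      case False
      text \<open>Replace \<open>g\<close> by an element \<open>h\<close> with the same value at \<open>x\<close> that fixes a third point
        of \<open>B\<close>: both \<open>h\<close> and \<open>h\<^sup>-\<^sup>1g\<close> then fix a point of \<open>B\<close>.\<close>
      have "act g x \<in> B" using maps[OF g x_in_B] .
      \<comment> \<open>Since \<open>g\<close> moves \<open>x\<close>, \<open>n\<close> is at least
        2; excluding 2 leaves a third point in \<open>B\<close>.\<close>
      with False x_in_B fin_B have "2 \<le> card B"
        using card_mono[of B "{x, act g x}"] by simp
      then have "\<not> B \<subseteq> {x, act g x}"
        using card_B \<open>n \<noteq> 2\<close> False card_mono[of "{x, act g x}" B] by auto
      then obtain z where z: "z \<in> B" "z \<noteq> x" "z \<noteq> act g x" by blast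
      let ?t = "Transposition.transpose x (act g x)"
      have "?t permutes B"
        using permutes_swap_id x_in_B \<open>act g x \<in> B\<close> by metis
      then have "restrict ?t B \<in> carrier (BijGroup B)"
        by (simp add: BijGroup_def Bij_def permutes_imp_bij)
      then obtain h where h: "h \<in> carrier G" and "restrict ?t B = induced_action act B h"
        using bij by (metis bij_betw_imp_surj_on imageE)
      then have "act h w = ?t w" if "w \<in> B" for w
        using that by (metis induced_action_def restrict_apply')
      then have hx: "act h x = act g x" and hz: "act h z = z"
        using x_in_B z by auto
      have "act (inv\<^bsub>G\<^esub> h \<otimes>\<^bsub>G\<^esub> g) x = x"
        using composition_rule[OF x, of "inv\<^bsub>G\<^esub> h" g] act_inv[OF h x] hx g h by simp
      then have "act (inv\<^bsub>G\<^esub> h) (act g y) = y"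
        using fixes_outside[OF _ x_in_B _ y(1) y_notin, of "inv\<^bsub>G\<^esub> h \<otimes>\<^bsub>G\<^esub> g"]
          composition_rule[OF y(1), of "inv\<^bsub>G\<^esub> h" g] g h by simp
      then have "act g y = act h y"
        using orbit_sym_aux[of "inv\<^bsub>G\<^esub> h" "act g y" y] act_closed[OF g y(1)] h by simp
      then show ?thesis using fixes_outside[OF h z(1) hz y(1) y_notin] by simp
    qed
    then have "Y = {y}"
      using y orbit_refl[OF y(1)] unfolding orbit_def by blast
    then show ?thesis by simp
  qed
  with bij card_B x show ?thesis unfolding B_def by blast
qed

end
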